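(* Let $\alpha, n$ be nonnegative integers and let $p_1,\dots,p_{\alpha+1}$ be primes (not necessarily distinct) such that $p_i\geq 5$ and $p_i\not\equiv 1 \pmod{12}$ for every $1\le i\le \alpha+1$. Then for any integer $j$ with $j \not\equiv 0 \pmod{p_{\alpha+1}}$, we have $$ b_3\left(p_1^2\cdots p_{\alpha+1}^2n+\frac{p_1^2\cdots p_{\alpha}^2p_{\alpha +1}(12j+p_{\alpha +1})-1}{12}\right)\equiv 0 \pmod{3}.$$
   Context: For a positive integer $\ell$, an $\ell$-regular partition of a nonnegative integer $n$ is a partition of $n$ none of whose parts is divisible by $\ell$. The number of $\ell$-regular partitions of $n$ is denoted $b_\ell(n)$, with the conventions $b_\ell(0)=1$ and $b_\ell(n)=0$ for $n<0$. Its generating function is $\sum_{n=0}^\infty b_\ell(n)q^n=\prod_{i\ge 1}\frac{1-q^{\ell i}}{1-q^i}$. When $\alpha=0$, the empty product $p_1^2\cdots p_\alpha^2$ equals $1$. *)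

theory Defs
  imports "HOL-Library.Multiset" "HOL-Number_Theory.Number_Theory"
begin

text \<open>A partition is the multiset of its (positive) parts.\<close>

definition regular_partitions :: "nat \<Rightarrow> nat \<Rightarrow> nat multiset set" where
  "regular_partitions l n =
     {M. sum_mset M = n \<and> (\<forall>x\<in>#M. 0 < x \<and> \<not> l dvd x)}"

text \<open>The counting function takes an integer argument, so that the convention that it
  vanishes on negative integers is part of the definition.\<close>

definition num_regular_partitions :: "nat \<Rightarrow> int \<Rightarrow> nat"  ("b\<^bsub>_\<^esub>") where
  "b\<^bsub>l\<^esub> n = (if n < 0 then 0 else card (regular_partitions l (nat n)))"

lemma finite_regular_partitions: "finite (regular_partitions l n)"
proof (rule finite_subset)
  show "regular_partitions l n \<subseteq>
          mset ` {xs. set xs \<subseteq> {..n} \<and> length xs \<le> n}"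
  proof
    fix M assume M: "M \<in> regular_partitions l n"
    obtain xs where xs: "M = mset xs" by (metis ex_mset)
    have s: "sum_list xs = n" and pos: "\<forall>x\<in>set xs. 0 < x"
      using M by (auto simp: regular_partitions_def xs sum_mset_sum_list)
    have "set xs \<subseteq> {..n}" using s member_le_sum_list by fastforce
    moreover have "length xs \<le> sum_list xs" using pos by (induction xs) auto
    ultimately show "M \<in> mset ` {xs. set xs \<subseteq> {..n} \<and> length xs \<le> n}"
      using s xs by auto
  qed
  show "finite (mset ` {xs. set xs \<subseteq> {..n} \<and> length xs \<le> n})"
    by (intro finite_imageI finite_lists_length_le) simp
qed

lemma num_regular_partitions_0: "b\<^bsub>l\<^esub> 0 = 1"
proof -
  have "M = {#}" if "M \<in> regular_partitions l 0" for M
  proof (cases M)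
    case (add x N)
    then show ?thesis using that by (auto simp: regular_partitions_def)
  qed
  then have "regular_partitions l 0 = {{#}}"
    by (auto simp: regular_partitions_def)
  then show ?thesis by (simp add: num_regular_partitions_def)
qed

text \<open>The division by \<open>12\<close> in the argument of \<open>b\<^bsub>3\<^esub>\<close> is written with the integer
  operation \<open>div\<close>; the lemma \<open>index_quotient_exact\<close> shows that it is exact.\<close>

lemma prime_square_cong_1_mod_12:
  fixes p :: nat
  assumes "prime p" and "5 \<le> p"
  shows "[int p ^ 2 = 1] (mod 12)"
proof -
  have "prime (2::nat)" "prime (3::nat)" by simp_all
  then have "2 dvd p \<Longrightarrow> 2 = p" "3 dvd p \<Longrightarrow> 3 = p"
    using assms(1) primes_dvd_imp_eq by blast+
  then have n2: "\<not> 2 dvd p" and n3: "\<not> 3 dvd p"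
    using assms(2) by linarith+
  have "\<forall>r\<in>{..<12::nat}. \<not> 2 dvd r \<longrightarrow> \<not> 3 dvd r \<longrightarrow> r ^ 2 mod 12 = 1"
    by (simp add: lessThan_nat_numeral lessThan_Suc)
  moreover have "\<not> 2 dvd p mod 12" "\<not> 3 dvd p mod 12"
    using n2 n3 by (simp_all add: dvd_mod_iff)
  ultimately have "(p mod 12) ^ 2 mod 12 = 1" by simp
  then have "[p ^ 2 = 1] (mod 12)" by (simp add: cong_def power_mod)
  then have "[int (p ^ 2) = int 1] (mod int 12)" by (simp only: cong_int_iff)
  then show ?thesis by simp
qed

lemma index_quotient_exact:
  fixes \<alpha> :: nat and p :: "nat \<Rightarrow> nat" and j :: int
  assumes "\<And>i. i \<in> {1..\<alpha> + 1} \<Longrightarrow> prime (p i) \<and> 5 \<le> p i"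
  shows "12 dvd ((\<Prod>i=1..\<alpha>. int (p i) ^ 2) * int (p (\<alpha> + 1)) *
                  (12 * j + int (p (\<alpha> + 1))) - 1)"
proof -
  let ?P = "\<Prod>i=1..\<alpha>. int (p i) ^ 2" and ?q = "int (p (\<alpha> + 1))"
  have "[?P = (\<Prod>i=1..\<alpha>. 1)] (mod 12)"
    using assms by (intro cong_prod prime_square_cong_1_mod_12) auto
  moreover have "[?q ^ 2 = 1] (mod 12)"
    using assms by (intro prime_square_cong_1_mod_12) auto
  ultimately have "[?P * ?q ^ 2 = 1 * 1] (mod 12)" by (intro cong_mult) auto
  then have "12 dvd ?P * ?q ^ 2 - 1" by (simp add: cong_iff_dvd_diff)
  then have "12 dvd (?P * ?q ^ 2 - 1) + 12 * (?P * ?q * j)" by simp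
  then show ?thesis by (simp add: algebra_simps power2_eq_square)
qed

end

theory Submission
  imports Defs "HOL-Computational_Algebra.Formal_Power_Series"
begin

text \<open>
  Write \<open>f\<^sub>k = \<Prod>i\<ge>1. 1 - X\<^bsup>ki\<^esup>\<close>.  Modulo 3 the generating function \<open>f\<^sub>3 / f\<^sub>1\<close> of the
  3-regular partitions is \<open>f\<^sub>1\<^sup>3 / f\<^sub>1 = f\<^sub>1\<^sup>2\<close> (lemma \<open>regular_partitions_cong\<close>), and
  \<open>f\<^sub>1\<^sup>2\<close> can be expanded as a theta series in two different ways.

  By Euler's pentagonal number theorem, \<open>f\<^sub>1\<close> only contains exponents \<open>e\<close> for which
  \<open>24e + 1\<close> is a square, so \<open>f\<^sub>1\<^sup>2\<close> only contains exponents \<open>m\<close> for which \<open>24m + 2\<close> is a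
  sum of two squares.  By Gauss's identity \<open>f\<^sub>1\<^sup>2 / f\<^sub>2 = \<Sum>z. (-1)\<^sup>z X\<^bsup>z\<^sup>2\<^esup>\<close>, where \<open>z\<close> runs over
  all integers, \<open>f\<^sub>1\<^sup>2\<close> is also the product of \<open>f\<^sub>2\<close> and this series, so it only contains
  exponents \<open>m\<close> for which \<open>12m + 1\<close> has the form \<open>x\<^sup>2 + 12z\<^sup>2\<close>.

  Now let \<open>q\<close> be the last of the primes and \<open>m\<close> the argument of \<open>b\<^bsub>3\<^esub>\<close>,
  which may be assumed nonnegative.  Then \<open>12m + 1\<close> is
  \<open>P\<^sup>2 q u\<close> with \<open>u\<close> prime to \<open>q\<close>, hence divisible by \<open>q\<close> to an odd power exactly.  A prime
  \<open>q \<ge> 5\<close> that is not 1 modulo 12 is 3 modulo 4 or 2 modulo 3.  In the first case \<open>-1\<close> is not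
  a square modulo \<open>q\<close>, and no sum of two squares is divisible by \<open>q\<close> to an odd power exactly;
  in the second case \<open>-3\<close> is not a square, and the same holds for \<open>x\<^sup>2 + 3(2z)\<^sup>2\<close>.  So in
  either case one of the two expansions shows that the coefficient of \<open>X\<^sup>m\<close> vanishes
  modulo 3.

  Only finitely many factors influence a given coefficient.  Infinite products therefore
  never appear: both theta identities are used in the finite forms due to Shanks, whose error
  terms are visibly divisible by \<open>X\<^bsup>n+1\<^esup>\<close>.
\<close>

unbundle fps_syntax

section \<open>Finite forms of two theta identities\<close>

definition qprod :: "'a::comm_ring_1 \<Rightarrow> nat \<Rightarrow> nat \<Rightarrow> 'a" where
  "qprod q m n = (\<Prod>i\<in>{m<..n}. 1 - q ^ i)"

definition qprod_plus :: "'a::comm_ring_1 \<Rightarrow> nat \<Rightarrow> 'a" where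
  "qprod_plus q n = (\<Prod>i\<in>{0<..n}. 1 + q ^ i)"

text \<open>The exponents are the generalized pentagonal numbers: \<open>s (3s - 1) / 2\<close> and \<open>s (3s + 1) / 2\<close>
  are the sums of \<open>s\<^sup>2\<close> and the triangular numbers with indices \<open>s - 1\<close> and \<open>s\<close>.\<close>

definition pentagonal_sum :: "'a::comm_ring_1 \<Rightarrow> nat \<Rightarrow> 'a" where
  "pentagonal_sum q n =
     1 + (\<Sum>s<n. (-1) ^ Suc s * (q ^ ((Suc s)\<^sup>2 + \<Sum>{..s}) + q ^ ((Suc s)\<^sup>2 + \<Sum>{..Suc s})))"

definition square_sum :: "'a::comm_ring_1 \<Rightarrow> nat \<Rightarrow> 'a" where
  "square_sum q n = 1 + 2 * (\<Sum>s<n. (-1) ^ Suc s * q ^ ((Suc s)\<^sup>2))"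

lemma qprod_self [simp]: "qprod q n n = 1"
  by (simp add: qprod_def)

lemma qprod_Suc_right: "m \<le> n \<Longrightarrow> qprod q m (Suc n) = qprod q m n * (1 - q ^ Suc n)"
proof -
  assume "m \<le> n"
  then have "{m<..Suc n} = insert (Suc n) {m<..n}" by auto
  then show ?thesis by (simp add: qprod_def mult.commute)
qed

lemma qprod_Suc_left: "m < n \<Longrightarrow> qprod q m n = (1 - q ^ Suc m) * qprod q (Suc m) n"
proof -
  assume "m < n"
  then have "{m<..n} = insert (Suc m) {Suc m<..n}" by auto
  then show ?thesis by (simp add: qprod_def)
qed

lemma qprod_split:
  assumes "m \<le> n"
  shows "qprod q 0 n = qprod q 0 m * qprod q m n"
proof -
  have "{0<..n} = {0<..m} \<union> {m<..n}" using assms by auto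
  then show ?thesis by (simp add: qprod_def prod.union_disjoint)
qed

lemma qprod_plus_0 [simp]: "qprod_plus q 0 = 1"
  by (simp add: qprod_plus_def)

lemma qprod_plus_Suc: "qprod_plus q (Suc n) = qprod_plus q n * (1 + q ^ Suc n)"
proof -
  have "{0<..Suc n} = insert (Suc n) {0<..n}" by auto
  then show ?thesis by (simp add: qprod_plus_def mult.commute)
qed

lemma qprod_mult_qprod_plus: "qprod q 0 n * qprod_plus q n = qprod (q\<^sup>2) 0 n"
  unfolding qprod_def qprod_plus_def prod.distrib [symmetric]
  by (intro prod.cong) (simp_all add: algebra_simps power2_eq_square power_mult_distrib)

lemma dvd_qprod_minus_1:
  "q ^ Suc m dvd qprod q m n - 1"
proof (cases "m \<le> n")
  case True
  then show ?thesis
  proof (induction n rule: dec_induct)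
    case (step n)
    have "q ^ Suc m dvd q ^ Suc n" using step by (intro le_imp_power_dvd) simp
    moreover have "qprod q m (Suc n) - 1 = (qprod q m n - 1) - qprod q m n * q ^ Suc n"
      using step by (simp add: qprod_Suc_right algebra_simps)
    ultimately show ?case using step by (metis dvd_diff dvd_mult)
  qed simp
next
  case False
  then show ?thesis by (simp add: qprod_def)
qed

text \<open>Shanks's finite form of the pentagonal number theorem.  Its summand with \<open>s = 0\<close> is the
  Euler product itself.  Replacing \<open>n\<close> by \<open>n + 1\<close> changes the summand with index \<open>s\<close> by
  \<open>(-1)\<^bsup>s+1\<^esup> (g (s - 1) + g s)\<close> for a suitable \<open>g\<close>, where \<open>g (- 1)\<close> counts as 0;
  these changes telescope, and what is left, with the summand that enters, is the new pair of pentagonal powers.\<close>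

lemma shanks_pentagonal:
  "(\<Sum>s\<le>n. (-1) ^ s * qprod q s n * q ^ (s * n + \<Sum>{..s})) = pentagonal_sum q n"
proof (induction n)
  case 0
  then show ?case by (simp add: pentagonal_sum_def)
next
  case (Suc n)
  define t where "t n s = (-1) ^ s * qprod q s n * q ^ (s * n + \<Sum>{..s})" for n s
  define g where "g s = qprod q s n * q ^ (Suc s * Suc n + \<Sum>{..s})" for s
  have tele: "(\<Sum>s\<le>m. t (Suc n) s) = (\<Sum>s\<le>m. t n s) + (-1) ^ Suc m * g m" if "m \<le> n" for m
    using that
  proof (induction m)
    case 0
    then show ?case by (simp add: t_def g_def qprod_Suc_right algebra_simps)
  next
    case (Suc m)
    define A where "A = qprod q (Suc m) n"
    define w where "w = q ^ (Suc m * n + \<Sum>{..Suc m})"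
    define a where "a = q ^ Suc m"
    define b where "b = q ^ Suc n"
    define e :: 'a where "e = (-1) ^ Suc m"
    have "q ^ (Suc m * Suc n + \<Sum>{..Suc m}) = w * a"
      unfolding w_def a_def power_add [symmetric] by (rule arg_cong [where f = "power q"]) simp
    then have 1: "t (Suc n) (Suc m) = e * (A * (1 - b)) * (w * a)"
      unfolding t_def e_def A_def b_def using Suc.prems by (simp only: qprod_Suc_right)
    have 2: "t n (Suc m) = e * A * w"
      by (simp only: t_def e_def A_def w_def)
    have "q ^ (Suc m * Suc n + \<Sum>{..m}) = w"
      unfolding w_def by (rule arg_cong [where f = "power q"]) simp
    then have 3: "g m = (1 - a) * A * w"
      unfolding g_def a_def A_def using Suc.prems by (simp only: qprod_Suc_left Suc_le_eq)
    have "q ^ (Suc (Suc m) * Suc n + \<Sum>{..Suc m}) = w * a * b"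
      unfolding w_def a_def b_def power_add [symmetric]
      by (rule arg_cong [where f = "power q"]) simp
    then have 4: "g (Suc m) = A * (w * a * b)"
      unfolding g_def A_def by simp
    have 5: "(-1) ^ Suc (Suc m) = - e" by (simp add: e_def)
    have "(\<Sum>s\<le>m. t (Suc n) s) = (\<Sum>s\<le>m. t n s) + e * g m"
      using Suc by (simp add: e_def)
    then show ?case
      unfolding sum.atMost_Suc 1 2 3 4 5 by (simp add: algebra_simps)
  qed
  have "(\<Sum>s\<le>Suc n. t (Suc n) s) = pentagonal_sum q n + (-1) ^ Suc n * g n + t (Suc n) (Suc n)"
    using tele [of n] Suc.IH by (simp add: t_def)
  also have "\<dots> = pentagonal_sum q (Suc n)"
    by (simp add: pentagonal_sum_def t_def g_def power2_eq_square algebra_simps)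
  finally show ?case by (simp add: t_def)
qed

text \<open>Shanks's finite form of Gauss's identity, multiplied by \<open>\<Prod>i\<le>n. 1 + q\<^sup>i\<close> so that it holds
  without division in every commutative ring.  The proof telescopes like the preceding one;
  because of the multiplier, the sum for \<open>n + 1\<close> is compared with \<open>1 + q\<^bsup>n+1\<^esup>\<close> times the sum
  for \<open>n\<close>.\<close>

lemma shanks_square:
  "qprod q 0 n + 2 * (\<Sum>s<n. (-1) ^ Suc s * q ^ (Suc s * Suc n) * qprod_plus q s * qprod q (Suc s) n)
     = qprod_plus q n * square_sum q n"
proof (induction n)
  case 0
  then show ?case by (simp add: square_sum_def)
next
  case (Suc n)
  define t where
    "t n s = (-1) ^ Suc s * q ^ (Suc s * Suc n) * qprod_plus q s * qprod q (Suc s) n" for n s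
  define g where "g s = q ^ (Suc s * Suc n) * qprod_plus q s * qprod q s n" for s
  define b where "b = q ^ Suc n"
  have tele: "qprod q 0 (Suc n) + 2 * (\<Sum>s<m. t (Suc n) s) =
      (1 + b) * (qprod q 0 n + 2 * (\<Sum>s<m. t n s)) + 2 * (-1) ^ Suc m * g m" if "m \<le> n" for m
    using that
  proof (induction m)
    case 0
    then show ?case by (simp add: b_def g_def qprod_Suc_right algebra_simps)
  next
    case (Suc m)
    define A where "A = qprod q (Suc m) n"
    define D where "D = qprod_plus q m"
    define w where "w = q ^ (Suc m * Suc n)"
    define a where "a = q ^ Suc m"
    define e :: 'a where "e = (-1) ^ Suc m"
    have "q ^ (Suc m * Suc (Suc n)) = w * a"
      unfolding w_def a_def power_add [symmetric] by (rule arg_cong [where f = "power q"]) simp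
    then have 1: "t (Suc n) m = e * (w * a) * D * (A * (1 - b))"
      unfolding t_def e_def A_def b_def D_def using Suc.prems by (simp only: qprod_Suc_right)
    have 2: "t n m = e * w * D * A"
      by (simp only: t_def e_def A_def w_def D_def)
    have 3: "g m = w * D * ((1 - a) * A)"
      unfolding g_def a_def A_def w_def D_def using Suc.prems
      by (simp only: qprod_Suc_left Suc_le_eq)
    have "q ^ (Suc (Suc m) * Suc n) = w * b"
      unfolding w_def b_def power_add [symmetric]
      by (rule arg_cong [where f = "power q"]) simp
    then have 4: "g (Suc m) = (w * b) * (D * (1 + a)) * A"
      unfolding g_def A_def D_def a_def qprod_plus_Suc by simp
    have 5: "(-1) ^ Suc (Suc m) = - e" by (simp add: e_def)
    have "qprod q 0 (Suc n) + 2 * (\<Sum>s<m. t (Suc n) s) =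
      (1 + b) * (qprod q 0 n + 2 * (\<Sum>s<m. t n s)) + 2 * e * g m"
      using Suc by (simp add: e_def)
    then show ?case
      unfolding sum.lessThan_Suc 1 2 3 4 5 by (simp add: algebra_simps)
  qed
  have "qprod q 0 (Suc n) + 2 * (\<Sum>s<Suc n. t (Suc n) s) =
      (1 + b) * (qprod_plus q n * square_sum q n) + 2 * (-1) ^ Suc n * g n + 2 * t (Suc n) n"
  proof -
    have IH: "qprod q 0 n + 2 * (\<Sum>s<n. t n s) = qprod_plus q n * square_sum q n"
      unfolding t_def by (rule Suc.IH)
    show ?thesis
      unfolding sum.lessThan_Suc distrib_left add.assoc [symmetric]
        tele [OF order_refl, unfolded IH distrib_left] by simp
  qed
  also have "\<dots> = qprod_plus q (Suc n) * square_sum q (Suc n)"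
  proof -
    define w where "w = q ^ ((Suc n)\<^sup>2)"
    define e :: 'a where "e = (-1) ^ Suc n"
    have 1: "g n = w * qprod_plus q n"
      by (simp add: g_def w_def power2_eq_square)
    have "q ^ (Suc n * Suc (Suc n)) = w * b"
      unfolding w_def b_def power_add [symmetric]
      by (rule arg_cong [where f = "power q"]) (simp add: power2_eq_square)
    then have 2: "t (Suc n) n = e * (w * b) * qprod_plus q n"
      by (simp only: t_def e_def qprod_self mult_1_right)
    have 3: "square_sum q (Suc n) = square_sum q n + 2 * (e * w)"
      by (simp add: square_sum_def e_def w_def algebra_simps)
    show ?thesis
      unfolding 1 2 3 qprod_plus_Suc b_def [symmetric] e_def [symmetric]
      by (simp add: algebra_simps)
  qed
  finally show ?case by (simp only: t_def)
qed

lemma qprod_pentagonal_dvd: "q ^ Suc n dvd qprod q 0 n - pentagonal_sum q n"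
proof -
  let ?t = "\<lambda>s. (-1) ^ s * qprod q s n * q ^ (s * n + \<Sum>{..s})"
  have "pentagonal_sum q n = ?t 0 + (\<Sum>s<n. ?t (Suc s))"
    unfolding shanks_pentagonal [symmetric] lessThan_Suc_atMost [symmetric]
    by (rule sum.lessThan_Suc_shift)
  then have "qprod q 0 n - pentagonal_sum q n = - (\<Sum>s<n. ?t (Suc s))" by simp
  moreover have "q ^ Suc n dvd (\<Sum>s<n. ?t (Suc s))"
    by (intro dvd_sum dvd_mult le_imp_power_dvd) simp
  ultimately show ?thesis by (simp only: dvd_minus_iff)
qed

lemma qprod_square_dvd: "q ^ Suc n dvd qprod q 0 n - qprod_plus q n * square_sum q n"
proof -
  let ?t = "\<lambda>s. (-1) ^ Suc s * q ^ (Suc s * Suc n) * qprod_plus q s * qprod q (Suc s) n"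
  have "qprod q 0 n - qprod_plus q n * square_sum q n = - (2 * (\<Sum>s<n. ?t s))"
    unfolding shanks_square [symmetric] by simp
  moreover have "q ^ Suc n dvd 2 * (\<Sum>s<n. ?t s)"
  proof (rule dvd_mult, rule dvd_sum)
    fix s
    have "q ^ Suc n dvd q ^ (Suc s * Suc n)" by (intro le_imp_power_dvd) simp
    then show "q ^ Suc n dvd ?t s" by (metis dvd_mult dvd_mult2)
  qed
  ultimately show ?thesis by (simp only: dvd_minus_iff)
qed

section \<open>The generating function modulo 3\<close>

definition partitions_into :: "nat set \<Rightarrow> nat \<Rightarrow> nat multiset set" where
  "partitions_into A n = {M. set_mset M \<subseteq> A \<and> sum_mset M = n}"

lemma finite_partitions_into:
  assumes "0 \<notin> A"
  shows "finite (partitions_into A n)"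
proof (rule finite_subset)
  show "partitions_into A n \<subseteq> regular_partitions (Suc n) n"
  proof
    fix M assume M: "M \<in> partitions_into A n"
    have "x \<le> n" "0 < x" if "x \<in># M" for x
      using M that assms sum_mset.remove [of x M]
      by (auto simp: partitions_into_def intro: gr0I)
    then show "M \<in> regular_partitions (Suc n) n"
      using M by (force simp: partitions_into_def regular_partitions_def dest: dvd_imp_le)
  qed
qed (rule finite_regular_partitions)

text \<open>A partition into parts from \<open>insert a A\<close> either avoids \<open>a\<close>, or arises from exactly one
  partition of \<open>n - a\<close> by adding a part \<open>a\<close>.\<close>

lemma card_partitions_into_insert:
  assumes "0 \<notin> A" and "a \<notin> A" and "0 < a"
  shows "card (partitions_into (insert a A) n) =
    card (partitions_into A n) + (if a \<le> n then card (partitions_into (insert a A) (n - a)) else 0)"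
proof -
  let ?B = "partitions_into (insert a A)"
  have fin: "finite (partitions_into A n)" "finite (?B k)" for k
    using assms by (auto intro!: finite_partitions_into)
  define C where "C = (if a \<le> n then add_mset a ` ?B (n - a) else {})"
  have "M \<in> partitions_into A n \<union> C" if M: "M \<in> ?B n" for M
  proof (cases "a \<in># M")
    case True
    then obtain N where N: "M = add_mset a N" by (metis insert_DiffM)
    then show ?thesis using M by (auto simp: partitions_into_def C_def)
  next
    case False
    then show ?thesis using M by (auto simp: partitions_into_def)
  qed
  moreover have "partitions_into A n \<union> C \<subseteq> ?B n"
    by (auto simp: partitions_into_def C_def split: if_splits)
  ultimately have "?B n = partitions_into A n \<union> C" by blast
  moreover have "partitions_into A n \<inter> C = {}"
  proof -
    have "a \<in># M" if "M \<in> C" for M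
      using that by (auto simp: C_def split: if_splits)
    moreover have "a \<notin># M" if "M \<in> partitions_into A n" for M
      using that assms(2) unfolding partitions_into_def by blast
    ultimately show ?thesis by blast
  qed
  moreover have "finite C" using fin by (simp add: C_def)
  moreover have "card C = (if a \<le> n then card (?B (n - a)) else 0)"
    by (simp add: C_def card_image inj_on_def)
  ultimately show ?thesis using fin by (simp add: card_Un_disjoint)
qed

definition partitions_into_gf :: "nat set \<Rightarrow> int fps" where
  "partitions_into_gf A = Abs_fps (\<lambda>n. int (card (partitions_into A n)))"

lemma partitions_into_gf_empty: "partitions_into_gf {} = 1"
proof (rule fps_ext)
  fix n
  have "partitions_into {} n = (if n = 0 then {{#}} else {})"
    by (auto simp: partitions_into_def)
  then show "partitions_into_gf {} $ n = 1 $ n" by (simp add: partitions_into_gf_def)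
qed

lemma partitions_into_gf_insert:
  assumes "0 \<notin> A" and "a \<notin> A" and "0 < a"
  shows "partitions_into_gf (insert a A) * (1 - fps_X ^ a) = partitions_into_gf A"
proof -
  have "partitions_into_gf (insert a A) =
      partitions_into_gf A + partitions_into_gf (insert a A) * fps_X ^ a"
  proof (rule fps_ext)
    fix n
    show "partitions_into_gf (insert a A) $ n =
        (partitions_into_gf A + partitions_into_gf (insert a A) * fps_X ^ a) $ n"
      unfolding partitions_into_gf_def fps_add_nth fps_X_power_mult_right_nth fps_nth_Abs_fps
      using card_partitions_into_insert [OF assms, of n] by auto
  qed
  then show ?thesis unfolding right_diff_distrib mult_1_right diff_eq_eq .
qed

lemma partitions_into_gf_mult_prod:
  assumes "finite A" and "0 \<notin> A"
  shows "partitions_into_gf A * (\<Prod>i\<in>A. 1 - fps_X ^ i) = 1"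
  using assms
proof (induction A rule: finite_induct)
  case empty
  show ?case by (simp add: partitions_into_gf_empty)
next
  case (insert a A)
  have "partitions_into_gf (insert a A) * (\<Prod>i\<in>insert a A. 1 - fps_X ^ i) =
      (partitions_into_gf (insert a A) * (1 - fps_X ^ a)) * (\<Prod>i\<in>A. 1 - fps_X ^ i)"
    unfolding prod.insert [OF insert.hyps] mult.assoc ..
  also have "\<dots> = partitions_into_gf A * (\<Prod>i\<in>A. 1 - fps_X ^ i)"
    using insert by (subst partitions_into_gf_insert) auto
  also have "\<dots> = 1"
    using insert by simp
  finally show ?case .
qed

text \<open>Factor by factor, this is \<open>1 - x\<^sup>3 = (1 - x)\<^sup>3\<close> modulo 3.\<close>

lemma qprod_cubes_cong:
  fixes q :: "'a::comm_ring_1"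
  shows "3 dvd qprod (q ^ 3) 0 n - qprod q 0 n ^ 3"
proof (induction n)
  case (Suc n)
  define x where "x = q ^ Suc n"
  define P where "P = qprod (q ^ 3) 0 n"
  define R where "R = qprod q 0 n"
  have "(q ^ 3) ^ Suc n = x ^ 3" 
    unfolding x_def power_mult [symmetric] by (rule arg_cong [where f = "power q"]) simp
  then have "qprod (q ^ 3) 0 (Suc n) - qprod q 0 (Suc n) ^ 3 = P * (1 - x ^ 3) - (R * (1 - x)) ^ 3"
    unfolding P_def R_def x_def by (simp only: qprod_Suc_right le0)
  also have "\<dots> = (P - R ^ 3) * (1 - x ^ 3) + 3 * (R ^ 3 * (x - x\<^sup>2))"
    by (simp add: algebra_simps power2_eq_square power3_eq_cube)
  finally show ?case using Suc.IH unfolding P_def R_def by (simp only: dvd_add dvd_triv_left dvd_mult2)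
qed simp

lemma fps_dvd_cancel_unit:
  fixes A B :: "int fps"
  assumes "c dvd A * B" and "A $ 0 = 1"
  shows "c dvd B"
proof -
  have "A * fps_right_inverse A 1 = 1"
    using assms(2) by (intro fps_right_inverse) simp
  then have "B = (A * B) * fps_right_inverse A 1"
    by (metis mult.assoc mult.commute mult_1_left)
  then show ?thesis using assms(1) by (metis dvd_mult2)
qed

lemma fps_nth_eq_of_X_power_dvd:
  fixes A B :: "'a::comm_ring_1 fps"
  assumes "fps_X ^ Suc n dvd A - B"
  shows "A $ n = B $ n"
proof -
  obtain C where "A - B = fps_X ^ Suc n * C" using assms by blast
  then have "(A - B) $ n = 0" by (simp only: fps_X_power_mult_nth) simp
  then show ?thesis by simp
qed

lemma qprod_X_nth_0: "qprod (fps_X :: int fps) 0 n $ 0 = 1"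
proof (induction n)
  case (Suc n)
  then show ?case by (simp only: qprod_Suc_right le0 fps_mult_nth_0) simp
qed simp

text \<open>With the parts bounded by \<open>3n\<close>, the generating function \<open>G\<close> satisfies
  \<open>G \<sqdot> \<Prod>i\<le>3n. (1 - X\<^sup>i) = \<Prod>i\<le>n. (1 - X\<^bsup>3i\<^esup>)\<close>, and modulo 3 the right-hand side is the cube of
  \<open>E = \<Prod>i\<le>n. (1 - X\<^sup>i)\<close>.  Cancelling one factor \<open>E\<close> leaves \<open>G R\<close> congruent to \<open>E\<^sup>2\<close>, where the
  remaining factors \<open>R\<close> differ from 1 only beyond \<open>X\<^sup>n\<close>.\<close>

lemma regular_partitions_cong:
  "[int (card (regular_partitions 3 n)) = (qprod (fps_X :: int fps) 0 n)\<^sup>2 $ n] (mod 3)"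
proof -
  define A where "A = {i \<in> {0<..3 * n}. \<not> 3 dvd i}"
  define G where "G = partitions_into_gf A"
  let ?E = "qprod (fps_X :: int fps) 0 n"
  let ?R = "qprod (fps_X :: int fps) n (3 * n)"
  have "{0<..3 * n} = A \<union> (\<lambda>i. 3 * i) ` {0<..n}" by (auto simp: A_def)
  moreover have "A \<inter> (\<lambda>i. 3 * i) ` {0<..n} = {}" by (auto simp: A_def)
  moreover have "finite A" by (simp add: A_def)
  ultimately have "qprod fps_X 0 (3 * n) =
      (\<Prod>i\<in>A. 1 - fps_X ^ i) * (\<Prod>i\<in>(\<lambda>i. 3 * i) ` {0<..n}. 1 - fps_X ^ i :: int fps)"
    unfolding qprod_def by (simp only: prod.union_disjoint finite_imageI finite_greaterThanAtMost)
  also have "(\<Prod>i\<in>(\<lambda>i. 3 * i) ` {0<..n}. 1 - fps_X ^ i :: int fps) = qprod (fps_X ^ 3) 0 n"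
    unfolding qprod_def by (subst prod.reindex) (auto simp: inj_on_def power_mult)
  finally have "G * qprod fps_X 0 (3 * n) = qprod (fps_X ^ 3) 0 n"
    using partitions_into_gf_mult_prod [of A] by (simp add: A_def G_def mult.assoc [symmetric])
  moreover have "qprod fps_X 0 (3 * n) = ?E * ?R" by (rule qprod_split) simp
  ultimately have "qprod (fps_X ^ 3) 0 n - ?E ^ 3 = ?E * (G * ?R - ?E\<^sup>2)"
    by (simp add: algebra_simps power2_eq_square power3_eq_cube)
  then have "3 dvd ?E * (G * ?R - ?E\<^sup>2)"
    using qprod_cubes_cong [of "fps_X :: int fps" n] by simp
  then have "3 dvd G * ?R - ?E\<^sup>2"
    using qprod_X_nth_0 by (rule fps_dvd_cancel_unit)
  then obtain H where "G * ?R - ?E\<^sup>2 = 3 * H" by blast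
  then have "(G * ?R - ?E\<^sup>2) $ n = (3 * H) $ n" by simp
  then have "(G * ?R) $ n - ?E\<^sup>2 $ n = 3 * H $ n"
    by (simp add: numeral_fps_const)
  moreover have "(G * ?R) $ n = G $ n"
  proof (rule fps_nth_eq_of_X_power_dvd)
    have "G * ?R - G = G * (?R - 1)" by (simp add: algebra_simps)
    then show "fps_X ^ Suc n dvd G * ?R - G" by (metis dvd_mult dvd_qprod_minus_1)
  qed
  moreover have "partitions_into A n = regular_partitions 3 n"
  proof -
    have "x \<le> n" if "x \<in># M" "sum_mset M = n" for x and M :: "nat multiset"
      using that sum_mset.remove [of x M] by auto
    then show ?thesis
      by (fastforce simp: partitions_into_def regular_partitions_def A_def subset_iff)
  qed
  ultimately have "int (card (regular_partitions 3 n)) - ?E\<^sup>2 $ n = 3 * H $ n"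
    by (simp add: G_def partitions_into_gf_def)
  then show ?thesis by (simp add: cong_iff_dvd_diff)
qed

section \<open>Quadratic forms representing the exponents\<close>

lemma fps_mult_nth_nonzeroE:
  fixes A B :: "'a::comm_ring_1 fps"
  assumes "(A * B) $ n \<noteq> 0"
  obtains i j where "i + j = n" and "A $ i \<noteq> 0" and "B $ j \<noteq> 0"
proof -
  from assms obtain i where "i \<in> {0..n}" "A $ i * B $ (n - i) \<noteq> 0"
    unfolding fps_mult_nth by (meson sum.not_neutral_contains_not_neutral)
  then show thesis using that [of i "n - i"] by fastforce
qed

lemma gauss_sum_double: "2 * \<Sum>{..s} = s * Suc (s::nat)"
  by (induction s) auto

text \<open>For a generalized pentagonal number \<open>e\<close>, the number \<open>24e + 1\<close> is a square.  The step
  \<open>d\<close> covers both \<open>f\<^sub>1\<close> and \<open>f\<^sub>2\<close>.\<close>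

lemma pentagonal_sum_support:
  assumes "pentagonal_sum (fps_X ^ d :: int fps) n $ k \<noteq> 0"
  shows "\<exists>x. 24 * k + d = d * x\<^sup>2"
proof -
  have pow: "((fps_X :: int fps) ^ d) ^ e $ k = (if k = d * e then 1 else 0)" for e
    by (simp only: power_mult [symmetric] fps_X_power_nth)
  have sgn: "((-1) ^ m * F) $ k = (-1) ^ m * F $ k" for m and F :: "int fps"
    by (cases "even m") auto
  have "k = 0 \<or> (\<exists>s. k = d * ((Suc s)\<^sup>2 + \<Sum>{..s})) \<or> (\<exists>s. k = d * ((Suc s)\<^sup>2 + \<Sum>{..Suc s}))"
  proof (rule ccontr)
    assume "\<not> ?thesis"
    then have "pentagonal_sum (fps_X ^ d :: int fps) n $ k = 0"
      unfolding pentagonal_sum_def fps_add_nth fps_sum_nth sgn pow by (auto intro!: sum.neutral)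
    then show False using assms by simp
  qed
  then show ?thesis
  \<comment> \<open>The roots are \<open>6t - 1\<close> and \<open>6t + 1\<close> for \<open>t = s + 1\<close>.\<close>
  proof (elim disjE exE)
    assume "k = 0"
    then show ?thesis by (intro exI [of _ 1]) simp
  next
    fix s assume k: "k = d * ((Suc s)\<^sup>2 + \<Sum>{..s})"
    have "24 * ((Suc s)\<^sup>2 + \<Sum>{..s}) + 1 = (6 * s + 5)\<^sup>2"
      using gauss_sum_double [of s] by (simp add: power2_eq_square algebra_simps)
    then have "24 * k + d = d * (6 * s + 5)\<^sup>2"
      unfolding k by (metis add_mult_distrib2 mult.left_commute mult.right_neutral)
    then show ?thesis ..
  next
    fix s assume k: "k = d * ((Suc s)\<^sup>2 + \<Sum>{..Suc s})"
    have "24 * ((Suc s)\<^sup>2 + \<Sum>{..Suc s}) + 1 = (6 * s + 7)\<^sup>2"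
      using gauss_sum_double [of "Suc s"] by (simp add: power2_eq_square algebra_simps)
    then have "24 * k + d = d * (6 * s + 7)\<^sup>2"
      unfolding k by (metis add_mult_distrib2 mult.left_commute mult.right_neutral)
    then show ?thesis ..
  qed
qed

lemma square_sum_support:
  assumes "square_sum (fps_X :: int fps) n $ k \<noteq> 0"
  shows "\<exists>z. k = z\<^sup>2"
proof (rule ccontr)
  assume no: "\<nexists>z. k = z\<^sup>2"
  have sgn: "((-1) ^ m * F) $ k = (-1) ^ m * F $ k" for m and F :: "int fps"
    by (cases "even m") auto
  have "k \<noteq> 0" using no by (metis zero_power2)
  then have "square_sum (fps_X :: int fps) n $ k = 0"
    using no unfolding square_sum_def fps_add_nth numeral_fps_const fps_mult_left_const_nth
      fps_sum_nth sgn fps_X_power_nth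
    by (auto intro!: sum.neutral)
  then show False using assms by simp
qed

lemma regular_partitions_sum_two_squares:
  assumes "\<not> [card (regular_partitions 3 n) = 0] (mod 3)"
  shows "\<exists>x y. x\<^sup>2 + y\<^sup>2 = 24 * n + 2"
proof -
  let ?E = "qprod (fps_X :: int fps) 0 n"
  let ?S = "pentagonal_sum (fps_X :: int fps) n"
  have "?E\<^sup>2 $ n \<noteq> 0"
    using assms regular_partitions_cong [of n] by (metis cong_int_iff of_nat_0 of_nat_numeral)
  moreover have "?E\<^sup>2 $ n = (?S * ?S) $ n"
  proof (rule fps_nth_eq_of_X_power_dvd)
    have "?E\<^sup>2 - ?S * ?S = (?E - ?S) * (?E + ?S)" by (simp add: algebra_simps power2_eq_square)
    then show "fps_X ^ Suc n dvd ?E\<^sup>2 - ?S * ?S" by (metis dvd_mult2 qprod_pentagonal_dvd)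
  qed
  ultimately obtain i j where ij: "i + j = n" "?S $ i \<noteq> 0" "?S $ j \<noteq> 0"
    by (metis fps_mult_nth_nonzeroE)
  then obtain x y where "24 * i + 1 = x\<^sup>2" "24 * j + 1 = y\<^sup>2"
    using pentagonal_sum_support [of 1] by (metis mult_1 power_one_right)
  then have "x\<^sup>2 + y\<^sup>2 = 24 * n + 2" using ij(1) by simp
  then show ?thesis by blast
qed

text \<open>With \<open>E = \<Prod>i\<le>n. (1 - X\<^sup>i)\<close> and \<open>D = \<Prod>i\<le>n. (1 + X\<^sup>i)\<close>, Gauss's identity turns \<open>E \<sqdot> E\<close> into
  \<open>E D\<close> times a sum over squares, and \<open>E D = \<Prod>i\<le>n. (1 - X\<^bsup>2i\<^esup>)\<close> is an Euler product in \<open>X\<^sup>2\<close>,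
  to which the pentagonal number theorem applies.\<close>

lemma regular_partitions_square_plus_12_square:
  assumes "\<not> [card (regular_partitions 3 n) = 0] (mod 3)"
  shows "\<exists>x z. x\<^sup>2 + 12 * z\<^sup>2 = 12 * n + 1"
proof -
  let ?E = "qprod (fps_X :: int fps) 0 n"
  let ?D = "qprod_plus (fps_X :: int fps) n"
  let ?P = "pentagonal_sum (fps_X\<^sup>2 :: int fps) n"
  let ?Q = "square_sum (fps_X :: int fps) n"
  have "?E\<^sup>2 $ n \<noteq> 0"
    using assms regular_partitions_cong [of n] by (metis cong_int_iff of_nat_0 of_nat_numeral)
  moreover have "?E\<^sup>2 $ n = (?P * ?Q) $ n"
  proof (rule fps_nth_eq_of_X_power_dvd)
    have "?E\<^sup>2 - ?P * ?Q = ?E * (?E - ?D * ?Q) + (?E * ?D - ?P) * ?Q"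
      by (simp add: algebra_simps power2_eq_square)
    moreover have "fps_X ^ Suc n dvd ?E * ?D - ?P"
    proof (rule dvd_trans)
      show "fps_X ^ Suc n dvd ((fps_X :: int fps)\<^sup>2) ^ Suc n"
        unfolding power_mult [symmetric] by (intro le_imp_power_dvd) simp
      show "((fps_X :: int fps)\<^sup>2) ^ Suc n dvd ?E * ?D - ?P"
        unfolding qprod_mult_qprod_plus by (rule qprod_pentagonal_dvd)
    qed
    ultimately show "fps_X ^ Suc n dvd ?E\<^sup>2 - ?P * ?Q"
      using qprod_square_dvd [of "fps_X :: int fps" n] by (metis dvd_add dvd_mult dvd_mult2)
  qed
  ultimately obtain i j where ij: "i + j = n" "?P $ i \<noteq> 0" "?Q $ j \<noteq> 0"
    by (metis fps_mult_nth_nonzeroE)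
  then obtain x z where "24 * i + 2 = 2 * x\<^sup>2" "j = z\<^sup>2"
    using pentagonal_sum_support [of 2] square_sum_support by metis
  then have "x\<^sup>2 + 12 * z\<^sup>2 = 12 * n + 1" using ij(1) by simp
  then show ?thesis by blast
qed

section \<open>Anisotropic forms modulo a prime\<close>

lemma fermat_theorem_int:
  fixes z :: int
  assumes "prime p" and "\<not> int p dvd z"
  shows "[z ^ (p - 1) = 1] (mod int p)"
proof -
  define a where "a = nat (z mod int p)"
  have a: "int a = z mod int p"
    using prime_gt_0_nat [OF assms(1)] by (simp add: a_def)
  have "\<not> int p dvd int a" using assms(2) unfolding a by (simp add: dvd_mod_iff)
  then have "[a ^ (p - 1) = 1] (mod p)"
    using assms(1) by (intro fermat_theorem) simp_all
  then have "[int a ^ (p - 1) = 1] (mod int p)"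
    by (metis cong_int_iff of_nat_1 of_nat_power)
  moreover have "[z ^ (p - 1) = int a ^ (p - 1)] (mod int p)"
    unfolding a by (intro cong_pow) (simp add: cong_def)
  ultimately show ?thesis by (rule cong_trans [rotated])
qed

text \<open>If \<open>y\<close> were invertible, raising \<open>x\<^sup>2 = - y\<^sup>2\<close> to the odd power \<open>(p - 1) / 2\<close> would give
  \<open>1 = - 1\<close> by Fermat's little theorem.  The factor 1 gives the form the shape
  \<open>x\<^sup>2 + d y\<^sup>2\<close> that the descent below expects.\<close>

lemma anisotropic_sum_two_squares:
  fixes x y :: int
  assumes p: "prime p" "p mod 4 = 3" and dvd: "int p dvd x\<^sup>2 + 1 * y\<^sup>2"
  shows "int p dvd x \<and> int p dvd y"
proof -
  have pp: "prime (int p)" using p by simp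
  define k where "k = p div 4"
  have k: "p = 4 * k + 3" using p(2) mult_div_mod_eq [of 4 p] by (simp add: k_def)
  have "int p dvd y"
  proof (rule ccontr)
    assume y: "\<not> int p dvd y"
    then have x: "\<not> int p dvd x"
      using dvd pp by (auto simp: prime_dvd_power_iff dvd_add_right_iff)
    have fermat: "[z ^ (4 * k + 2) = 1] (mod int p)" if "\<not> int p dvd z" for z
    proof -
      have "[z ^ (p - 1) = 1] (mod int p)"
        using p(1) that by (rule fermat_theorem_int)
      then show ?thesis by (simp add: k)
    qed
    have "[x\<^sup>2 = - (y\<^sup>2)] (mod int p)" using dvd by (simp add: cong_iff_dvd_diff)
    then have "[(x\<^sup>2) ^ (2 * k + 1) = (- (y\<^sup>2)) ^ (2 * k + 1)] (mod int p)" by (rule cong_pow)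
    moreover have "(x\<^sup>2) ^ (2 * k + 1) = x ^ (4 * k + 2)"
      unfolding power_mult [symmetric] by simp
    moreover have "(- (y\<^sup>2)) ^ (2 * k + 1) = - (y ^ (4 * k + 2))"
    proof -
      have "(- (y\<^sup>2)) ^ (2 * k + 1) = - ((y\<^sup>2) ^ (2 * k + 1))" by (rule power_minus_odd) simp
      also have "(y\<^sup>2) ^ (2 * k + 1) = y ^ (4 * k + 2)"
        unfolding power_mult [symmetric] by simp
      finally show ?thesis .
    qed
    ultimately have "[x ^ (4 * k + 2) = - (y ^ (4 * k + 2))] (mod int p)" by simp
    moreover have "[- (y ^ (4 * k + 2)) = - 1] (mod int p)"
      using fermat [OF y] by (simp only: cong_minus_minus_iff)
    ultimately have "[1 = - 1] (mod int p)"
      using fermat [OF x] by (meson cong_sym cong_trans)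
    then have "int p dvd 2" by (simp add: cong_iff_dvd_diff)
    then have "int p \<le> 2" by (rule zdvd_imp_le) simp
    then show False using k by simp
  qed
  moreover from this have "int p dvd x"
    using dvd pp by (auto simp: prime_dvd_power_iff dvd_add_left_iff)
  ultimately show ?thesis by simp
qed

text \<open>For \<open>p = 3k + 2\<close>, raising to the power \<open>2k + 1\<close> inverts cubing, because
  \<open>3 (2k + 1) = 1 + 2 (p - 1)\<close>.\<close>

lemma cube_inj_mod_prime:
  fixes a b :: int
  assumes p: "prime p" "p mod 3 = 2" and cubes: "[a ^ 3 = b ^ 3] (mod int p)"
  shows "[a = b] (mod int p)"
proof -
  define k where "k = p div 3"
  have k: "p = 3 * k + 2" using p(2) mult_div_mod_eq [of 3 p] by (simp add: k_def)
  have inv: "[(z ^ 3) ^ (2 * k + 1) = z] (mod int p)" for z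
  proof -
    have e: "(z ^ 3) ^ (2 * k + 1) = z * (z ^ (p - 1))\<^sup>2"
      unfolding power_mult [symmetric] power_Suc [symmetric]
      by (rule arg_cong [where f = "power z"]) (simp add: k)
    show ?thesis
    proof (cases "int p dvd z")
      case True
      then have "int p dvd z * (z ^ (p - 1))\<^sup>2 - z" by simp
      then show ?thesis unfolding e by (simp add: cong_iff_dvd_diff)
    next
      case False
      then have "[z ^ (p - 1) = 1] (mod int p)"
        using p(1) by (intro fermat_theorem_int)
      then have "[z * (z ^ (p - 1))\<^sup>2 = z * 1\<^sup>2] (mod int p)"
        by (intro cong_mult cong_pow cong_refl)
      then show ?thesis unfolding e by simp
    qed
  qed
  have "[(a ^ 3) ^ (2 * k + 1) = (b ^ 3) ^ (2 * k + 1)] (mod int p)"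
    using cubes by (rule cong_pow)
  then show ?thesis using inv by (meson cong_sym cong_trans)
qed

text \<open>A square root of \<open>-3\<close> would give a nontrivial cube root of unity, which does not exist
  modulo a prime that is 2 modulo 3.  Without division: \<open>x\<^sup>2 + 3y\<^sup>2\<close> divides
  \<open>(x + y)\<^sup>3 - (-2y)\<^sup>3\<close>, so \<open>x + y\<close> and \<open>-2y\<close> have the same cube and hence agree modulo
  \<open>p\<close>.\<close>

lemma anisotropic_square_plus_3_square:
  fixes x y :: int
  assumes p: "prime p" "5 \<le> p" "p mod 3 = 2" and dvd: "int p dvd x\<^sup>2 + 3 * y\<^sup>2"
  shows "int p dvd x \<and> int p dvd y"
proof -
  have pp: "prime (int p)" using p by simp
  have small: "\<not> int p dvd 2" "\<not> int p dvd 3"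
    using p(2) by (auto dest!: zdvd_imp_le)
  have "(x + y) ^ 3 - (- 2 * y) ^ 3 = (x\<^sup>2 + 3 * y\<^sup>2) * (x + 3 * y)"
    by (simp add: algebra_simps power2_eq_square power3_eq_cube)
  then have "[(x + y) ^ 3 = (- 2 * y) ^ 3] (mod int p)"
    using dvd by (simp add: cong_iff_dvd_diff)
  then have "[x + y = - 2 * y] (mod int p)"
    by (rule cube_inj_mod_prime [OF p(1,3)])
  then have xy: "int p dvd x + 3 * y" by (simp add: cong_iff_dvd_diff add.commute)
  \<comment> \<open>Since \<open>x = -3y\<close> modulo \<open>p\<close>, the form takes the value \<open>12y\<^sup>2\<close>; the factors of 12 are
    kept apart so that primality applies to each of them.\<close>
  have "2 * (2 * (3 * y\<^sup>2)) = (x\<^sup>2 + 3 * y\<^sup>2) - (x + 3 * y) * (x - 3 * y)"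
    by (simp add: algebra_simps power2_eq_square)
  then have "int p dvd 2 * (2 * (3 * y\<^sup>2))" using dvd xy by (metis dvd_diff dvd_mult2)
  then have "int p dvd y"
    using small
    by (simp only: prime_dvd_mult_iff [OF pp] prime_dvd_power_iff [OF pp zero_less_numeral] simp_thms)
  moreover from this have "int p dvd x" using xy by (simp add: dvd_add_left_iff)
  ultimately show ?thesis by simp
qed

text \<open>Infinite descent: \<open>p\<close> divides \<open>x\<close> and \<open>y\<close>, so \<open>p\<^sup>2\<close> divides both sides; since \<open>p\<close> does not
  divide \<open>u\<close>, it divides \<open>P\<close>, and \<open>p\<^sup>2\<close> cancels from the whole equation.\<close>

lemma anisotropic_not_odd_multiplicity:
  fixes p d u :: int
  assumes p: "prime p"
    and aniso: "\<And>x y. p dvd x\<^sup>2 + d * y\<^sup>2 \<Longrightarrow> p dvd x \<and> p dvd y"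
    and u: "\<not> p dvd u"
    and P: "P \<noteq> 0"
  shows "x\<^sup>2 + d * y\<^sup>2 \<noteq> P\<^sup>2 * p * u"
  using P
proof (induction "nat \<bar>P\<bar>" arbitrary: P x y rule: less_induct)
  case less
  show ?case
  proof
    assume eq: "x\<^sup>2 + d * y\<^sup>2 = P\<^sup>2 * p * u"
    have "p dvd x \<and> p dvd y" by (rule aniso) (simp add: eq)
    then obtain x' y' where xy: "x = p * x'" "y = p * y'" by (elim conjE dvdE)
    have "p * (p * (x'\<^sup>2 + d * y'\<^sup>2)) = p * (P\<^sup>2 * u)"
      using eq unfolding xy by (simp add: algebra_simps power2_eq_square)
    then have *: "p * (x'\<^sup>2 + d * y'\<^sup>2) = P\<^sup>2 * u" using p by auto
    then have "p dvd P\<^sup>2 * u" by (metis dvd_triv_left)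
    then have "p dvd P" using p u by (simp add: prime_dvd_mult_iff prime_dvd_power_iff)
    then obtain P' where P': "P = p * P'" ..
    have "p * (x'\<^sup>2 + d * y'\<^sup>2) = p * (P'\<^sup>2 * p * u)"
      using * unfolding P' by (simp add: algebra_simps power2_eq_square)
    then have "x'\<^sup>2 + d * y'\<^sup>2 = P'\<^sup>2 * p * u" using p by auto
    moreover have "P' \<noteq> 0" using less.prems P' by auto
    moreover have "nat \<bar>P'\<bar> < nat \<bar>P\<bar>"
      using \<open>P' \<noteq> 0\<close> prime_gt_1_int [OF p] unfolding P' by (simp add: abs_mult)
    ultimately show False using less.hyps by blast
  qed
qed

section \<open>The congruence\<close>

lemma regular_partitions_3_cong_0:
  fixes P u :: int
  assumes p: "prime p" "5 \<le> p" "\<not> [p = 1] (mod 12)"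
    and n: "12 * int n + 1 = P\<^sup>2 * int p * u" and u: "\<not> int p dvd u"
  shows "[card (regular_partitions 3 n) = 0] (mod 3)"
proof (rule ccontr)
  assume nz: "\<not> ?thesis"
  have pp: "prime (int p)" using p by simp
  have P: "P \<noteq> 0" using n by (auto simp: power2_eq_square)
  have "\<not> 2 dvd p" "\<not> 3 dvd p"
    using p(1,2) primes_dvd_imp_eq [of 2 p] primes_dvd_imp_eq [of 3 p] by auto
  moreover have "p mod 12 \<noteq> 1" using p(3) by (simp add: cong_def)
  ultimately have "p mod 4 = 3 \<or> p mod 3 = 2" by presburger
  then consider "p mod 4 = 3" | "p mod 3 = 2" by blast
  then show False
  proof cases
    case 1
    obtain x y where "x\<^sup>2 + y\<^sup>2 = 24 * n + 2"
      using regular_partitions_sum_two_squares [OF nz] by blast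
    then have "int (x\<^sup>2 + y\<^sup>2) = int (24 * n + 2)" by simp
    then have "(int x)\<^sup>2 + 1 * (int y)\<^sup>2 = P\<^sup>2 * int p * (2 * u)" using n by simp
    moreover have "\<not> int p dvd 2 * u"
      using u pp p(2) by (auto simp: prime_dvd_mult_iff dest: zdvd_imp_le)
    ultimately show False
      using anisotropic_not_odd_multiplicity [OF pp anisotropic_sum_two_squares [OF p(1) 1]] P
      by blast
  next
    case 2
    obtain x z where "x\<^sup>2 + 12 * z\<^sup>2 = 12 * n + 1"
      using regular_partitions_square_plus_12_square [OF nz] by blast
    then have "int (x\<^sup>2 + 12 * z\<^sup>2) = int (12 * n + 1)" by simp
    then have "(int x)\<^sup>2 + 3 * (2 * int z)\<^sup>2 = P\<^sup>2 * int p * u" using n by simp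
    then show False
      using anisotropic_not_odd_multiplicity
        [OF pp anisotropic_square_plus_3_square [OF p(1,2) 2] u P]
      by blast
  qed
qed

theorem theorem1p1:
  fixes \<alpha> n :: nat and p :: "nat \<Rightarrow> nat" and j :: int
  assumes "\<And>i. i \<in> {1..\<alpha> + 1} \<Longrightarrow> prime (p i)"
    and "\<And>i. i \<in> {1..\<alpha> + 1} \<Longrightarrow> 5 \<le> p i"
    and "\<And>i. i \<in> {1..\<alpha> + 1} \<Longrightarrow> \<not> [p i = 1] (mod 12)"
    and "\<not> [j = 0] (mod int (p (\<alpha> + 1)))"
  shows "[b\<^bsub>3\<^esub> ((\<Prod>i=1..\<alpha> + 1. int (p i) ^ 2) * int n
            + ((\<Prod>i=1..\<alpha>. int (p i) ^ 2) * int (p (\<alpha> + 1))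
                * (12 * j + int (p (\<alpha> + 1))) - 1) div 12) = 0] (mod 3)"
proof -
  define q where "q = p (\<alpha> + 1)"
  define P where "P = (\<Prod>i=1..\<alpha>. int (p i))"
  define k where "k = (P\<^sup>2 * int q * (12 * j + int q) - 1) div 12"
  define N where "N = P\<^sup>2 * int q ^ 2 * int n + k"
  have q: "prime q" "5 \<le> q" "\<not> [q = 1] (mod 12)" using assms(1-3) by (auto simp: q_def)
  have sq: "(\<Prod>i=1..\<alpha>. int (p i) ^ 2) = P\<^sup>2" by (simp add: P_def prod_power_distrib)
  have "12 dvd P\<^sup>2 * int q * (12 * j + int q) - 1"
    using index_quotient_exact [of \<alpha> p j] assms(1,2) unfolding sq q_def by blast
  then have "12 * k = P\<^sup>2 * int q * (12 * j + int q) - 1" by (simp add: k_def)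
  then have N: "12 * N + 1 = P\<^sup>2 * int q * (12 * (int q * int n + j) + int q)"
    by (simp add: N_def algebra_simps power2_eq_square)
  have u: "\<not> int q dvd 12 * (int q * int n + j) + int q"
  proof
    assume "int q dvd 12 * (int q * int n + j) + int q"
    then have "int q dvd 12 * (int q * int n + j)" by simp
    moreover have "coprime (int q) 12"
    proof -
      have "\<not> q dvd 2" "\<not> q dvd 3" using q(2) by (auto dest!: dvd_imp_le)
      then have "\<not> q dvd 2 * 2 * 3" using q(1) by (simp only: prime_dvd_mult_iff) simp
      then have "coprime q 12" using q(1) by (simp add: prime_imp_coprime)
      then show ?thesis by (metis coprime_int_iff of_nat_numeral)
    qed
    ultimately have "int q dvd int q * int n + j" by (metis coprime_dvd_mult_right_iff)
    then have "int q dvd j" by (simp add: dvd_add_right_iff)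
    then show False using assms(4) by (simp add: q_def cong_0_iff)
  qed
  have "[b\<^bsub>3\<^esub> N = 0] (mod 3)"
  proof (cases "N < 0")
    case True
    then show ?thesis by (simp add: num_regular_partitions_def)
  next
    case False
    then have "int (nat N) = N" by simp
    then have "12 * int (nat N) + 1 = P\<^sup>2 * int q * (12 * (int q * int n + j) + int q)"
      using N by (simp only:)
    then have "[card (regular_partitions 3 (nat N)) = 0] (mod 3)"
      using u by (rule regular_partitions_3_cong_0 [OF q])
    then show ?thesis using False by (simp add: num_regular_partitions_def)
  qed
  moreover have "(\<Prod>i=1..\<alpha> + 1. int (p i) ^ 2) = P\<^sup>2 * int q ^ 2"
    using sq by (simp add: q_def)
  ultimately show ?thesis unfolding N_def k_def sq q_def by (simp only:)
qed

end
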